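(* The (even) second cohomology of the super $w_\infty$ $3$-algebra with values in the trivial module $\mathbb{C}$ vanishes, i.e. $$H_0^2(w_\infty,\mathbb{C})=\{0\}.$$
   Context: $\mathbb{N}=\{0,1,2,\dots\}$. The super $w_\infty$ $3$-algebra is the complex vector superspace $w_\infty=(w_\infty)_0\oplus(w_\infty)_1$ where $(w_\infty)_0$ has basis $L_n^i,\overline{L}_n^i$ and $(w_\infty)_1$ has basis $h_n^{i+\frac12},\overline{h}_n^{i+\frac12}$ ($n\in\mathbb{Z}$, $i\in\mathbb{N}$), with the even trilinear super skew-symmetric bracket (i.e. exchanging adjacent homogeneous arguments $a,b$ multiplies it by $-(-1)^{|a||b|}$) $$\begin{aligned} [L_m^i,L_n^j,L_k^h]&=(h(n-m)+j(m-k)+i(k-n))L_{m+n+k}^{i+j+h-1},\\ [L_m^i,L_n^j,\overline{L}_k^h]&=(h(n-m)+j(m-k)+i(k-n))\overline{L}_{m+n+k}^{i+j+h-1},\\ [L_m^i,L_n^j,h_p^{\alpha+\frac12}]&=(\alpha(n-m)+j(m-p)+i(p-n))h_{m+n+p}^{i+j+\alpha-1+\frac12},\\ [L_m^i,L_n^j,\overline{h}_r^{\alpha+\frac12}]&=(\alpha(n-m)+j(m-r)+i(r-n))\overline{h}_{m+n+r}^{i+j+\alpha-1+\frac12},\\ [L_m^i,h_p^{\alpha+\frac12},\overline{h}_r^{\beta+\frac12}]&=(i(p-r)+\alpha(r-m)+\beta(m-p))\overline{L}_{m+r+p}^{i+\alpha+\beta-1}, \end{aligned}$$ all other brackets being obtained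 by super skew-symmetry or equal to $0$. (When the upper index on the right would be $-1$ or $-\frac12$, the coefficient is $0$.) Write $\mathcal{N}=w_\infty$ and $\mathcal{L}(\mathcal{N})=\wedge^2\mathcal{N}$ (super exterior square, $u\wedge v=-(-1)^{|u||v|}v\wedge u$). For $x=x_1\wedge x_2$, $y=y_1\wedge y_2$ and $z\in\mathcal{N}$ put $[x,z]=[x_1,x_2,z]$ and $[x,y]_L=[x,y_1]\wedge y_2+(-1)^{|x||y_1|}y_1\wedge[x,y_2]$. The trivial module $\mathbb{C}$ is purely even with zero module bracket. With trivial coefficients, $Z^2(\mathcal{N},\mathbb{C})$ is the space of bilinear maps $f:\mathcal{L}(\mathcal{N})\times\mathcal{N}\to\mathbb{C}$ with $\delta^2f=0$, where $$\delta^2(f)(x,y,z)=-f([x,y]_L,z)-(-1)^{|x||y|}f(y,[x,z])+f(x,[y,z])$$ for homogeneous $x,y\in\mathcal{L}(\mathcal{N})$, $z\in\mathcal{N}$, and $B^2(\mathcal{N},\mathbb{C})$ is the space of maps $\delta^1(g)$, $\delta^1(g)(x,z)=-g([x,z])$, with $g:\mathcal{N}\to\mathbb{C}$ linear. $Z_0^2$ and $B_0^2$ are the subspaces of even maps in $Z^2$ and $B^2$, and $H_0^2(\mathcal{N},\mathbb{C})=Z_0^2/B_0^2$. *)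

theory Defs
  imports Complex_Main "HOL-Library.Poly_Mapping"
begin

section \<open>Complex vector spaces with a given basis\<close>

text \<open>The type \<open>'a \<Rightarrow>\<^sub>0 complex\<close> is the complex vector space with basis
  \<open>single a 1\<close>, \<open>a :: 'a\<close>.\<close>

definition cscale :: "complex \<Rightarrow> ('a \<Rightarrow>\<^sub>0 complex) \<Rightarrow> ('a \<Rightarrow>\<^sub>0 complex)" where
  "cscale c u = Poly_Mapping.map ((*) c) u"

lemma lookup_cscale [simp]: "Poly_Mapping.lookup (cscale c u) a = c * Poly_Mapping.lookup u a"
  by (simp add: cscale_def Poly_Mapping.map.rep_eq when_def)

interpretation pm: vector_space cscale
  by unfold_locales (auto intro!: poly_mapping_eqI simp: lookup_add algebra_simps)

abbreviation bas :: "'a \<Rightarrow> 'a \<Rightarrow>\<^sub>0 complex" where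
  "bas a \<equiv> Poly_Mapping.single a 1"

text \<open>The linear map into the space with scalar multiplication \<open>sc\<close> that takes the
  values \<open>F a\<close> on the basis.\<close>

definition lin_ext :: "(complex \<Rightarrow> 'v \<Rightarrow> 'v) \<Rightarrow> ('a \<Rightarrow> 'v) \<Rightarrow> ('a \<Rightarrow>\<^sub>0 complex) \<Rightarrow> 'v::ab_group_add" where
  "lin_ext sc F u = (\<Sum>a\<in>Poly_Mapping.keys u. sc (Poly_Mapping.lookup u a) (F a))"

lemma lin_ext_superset:
  assumes "vector_space sc" "finite A" "Poly_Mapping.keys u \<subseteq> A"
  shows "lin_ext sc F u = (\<Sum>a\<in>A. sc (Poly_Mapping.lookup u a) (F a))"
proof -
  interpret vector_space sc by fact
  show ?thesis unfolding lin_ext_def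
    by (rule sum.mono_neutral_left) (use assms in \<open>auto simp: in_keys_iff\<close>)
qed

lemma vlinearI:
  assumes "vector_space s" "vector_space sc" "\<And>x y. F (x + y) = F x + F y" "\<And>c x. F (s c x) = sc c (F x)"
  shows "Vector_Spaces.linear s sc F"
  using assms by (simp add: Vector_Spaces.linear_iff)

lemma linear_scale_right:
  assumes "Vector_Spaces.linear s sc F"
  shows "Vector_Spaces.linear s sc (\<lambda>x. sc c (F x))"
proof -
  interpret F: Vector_Spaces.linear s sc F by fact
  interpret P: vector_space_pair s sc by unfold_locales
  show ?thesis by (rule P.linear_compose_scale_right[OF assms])
qed

lemma linear_lin_ext:
  assumes "vector_space sc"
  shows "Vector_Spaces.linear cscale sc (lin_ext sc F)"
proof -
  interpret V: vector_space sc by fact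
  show ?thesis
  proof (rule vlinearI[OF pm.vector_space_axioms assms])
    fix u v :: "'b \<Rightarrow>\<^sub>0 complex"
    let ?A = "Poly_Mapping.keys u \<union> Poly_Mapping.keys v"
    have "Poly_Mapping.keys (u + v) \<subseteq> ?A" by (rule keys_add)
    then show "lin_ext sc F (u + v) = lin_ext sc F u + lin_ext sc F v"
      by (simp add: lin_ext_superset[OF assms, of ?A] lookup_add V.scale_left_distrib sum.distrib)
  next
    fix c and u :: "'b \<Rightarrow>\<^sub>0 complex"
    let ?A = "Poly_Mapping.keys u"
    have "Poly_Mapping.keys (cscale c u) \<subseteq> ?A" by (auto simp: in_keys_iff)
    then show "lin_ext sc F (cscale c u) = sc c (lin_ext sc F u)"
      by (simp add: lin_ext_superset[OF assms, of ?A] V.scale_sum_right)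
  qed
qed

lemma lin_ext_bas [simp]: "vector_space sc \<Longrightarrow> lin_ext sc F (bas a) = F a"
  by (simp add: lin_ext_def vector_space.vector_space_assms(4))

lemma lin_ext_bas_self: "lin_ext cscale bas u = u"
proof (rule poly_mapping_eqI)
  fix k
  have "Poly_Mapping.lookup (lin_ext cscale bas u) k = (\<Sum>a\<in>Poly_Mapping.keys u. if a = k then Poly_Mapping.lookup u a else 0)"
    unfolding lin_ext_def lookup_sum by (rule sum.cong) (auto simp: lookup_single when_def)
  also have "\<dots> = Poly_Mapping.lookup u k" by (simp add: in_keys_iff)
  finally show "Poly_Mapping.lookup (lin_ext cscale bas u) k = Poly_Mapping.lookup u k" .
qed

lemma linear_eq_on_supp:
  assumes "Vector_Spaces.linear cscale sc F" "Vector_Spaces.linear cscale sc G"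
    and "\<And>a. a \<in> Poly_Mapping.keys u \<Longrightarrow> F (bas a) = G (bas a)"
  shows "F u = G u"
proof -
  interpret F: Vector_Spaces.linear cscale sc F by fact
  interpret G: Vector_Spaces.linear cscale sc G by fact
  have "F (lin_ext cscale bas u) = G (lin_ext cscale bas u)"
    unfolding lin_ext_def F.sum G.sum F.scale G.scale using assms(3) by simp
  then show ?thesis by (simp add: lin_ext_bas_self)
qed

section \<open>The super \<open>w\<^sub>\<infinity>\<close> 3-algebra\<close>

text \<open>\<open>L n i\<close>, \<open>Lbar n i\<close>, \<open>H n i\<close>, \<open>Hbar n i\<close> stand for the basis vectors with lower
  index \<open>n\<close> and upper index \<open>i\<close>, \<open>i\<close>, \<open>i + 1/2\<close>, \<open>i + 1/2\<close> respectively.\<close>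

datatype gen = L int nat | Lbar int nat | H int nat | Hbar int nat

type_synonym w_inf = "gen \<Rightarrow>\<^sub>0 complex"

fun par :: "gen \<Rightarrow> nat" where
  "par (L _ _) = 0"
| "par (Lbar _ _) = 0"
| "par (H _ _) = 1"
| "par (Hbar _ _) = 1"

text \<open>The homogeneous component of degree \<open>d mod 2\<close>.\<close>

definition w_comp :: "nat \<Rightarrow> w_inf set" where
  "w_comp d = {u. \<forall>a\<in>Poly_Mapping.keys u. par a = d mod 2}"

text \<open>The five defining brackets. Subtraction in the upper index is truncated only
  when all three upper indices are 0, and then the coefficient is 0.\<close>

fun brk0 :: "gen \<Rightarrow> gen \<Rightarrow> gen \<Rightarrow> w_inf" where
  "brk0 (L m i) (L n j) (L k l) =
     cscale (of_int (int l * (n - m) + int j * (m - k) + int i * (k - n))) (bas (L (m + n + k) (i + j + l - 1)))"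
| "brk0 (L m i) (L n j) (Lbar k l) =
     cscale (of_int (int l * (n - m) + int j * (m - k) + int i * (k - n))) (bas (Lbar (m + n + k) (i + j + l - 1)))"
| "brk0 (L m i) (L n j) (H p \<alpha>) =
     cscale (of_int (int \<alpha> * (n - m) + int j * (m - p) + int i * (p - n))) (bas (H (m + n + p) (i + j + \<alpha> - 1)))"
| "brk0 (L m i) (L n j) (Hbar r \<alpha>) =
     cscale (of_int (int \<alpha> * (n - m) + int j * (m - r) + int i * (r - n))) (bas (Hbar (m + n + r) (i + j + \<alpha> - 1)))"
| "brk0 (L m i) (H p \<alpha>) (Hbar r \<beta>) =
     cscale (of_int (int i * (p - r) + int \<alpha> * (r - m) + int \<beta> * (m - p))) (bas (Lbar (m + r + p) (i + \<alpha> + \<beta> - 1)))"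
| "brk0 _ _ _ = 0"

text \<open>The bracket on the basis; see \<open>brk_swap12\<close> and \<open>brk_swap23\<close> for the super
  skew-symmetry.\<close>

fun brk :: "gen \<Rightarrow> gen \<Rightarrow> gen \<Rightarrow> w_inf" where
  "brk (L m i) (Lbar k l) (L n j) = - brk0 (L m i) (L n j) (Lbar k l)"
| "brk (Lbar k l) (L m i) (L n j) = brk0 (L m i) (L n j) (Lbar k l)"
| "brk (L m i) (H p \<alpha>) (L n j) = - brk0 (L m i) (L n j) (H p \<alpha>)"
| "brk (H p \<alpha>) (L m i) (L n j) = brk0 (L m i) (L n j) (H p \<alpha>)"
| "brk (L m i) (Hbar r \<alpha>) (L n j) = - brk0 (L m i) (L n j) (Hbar r \<alpha>)"
| "brk (Hbar r \<alpha>) (L m i) (L n j) = brk0 (L m i) (L n j) (Hbar r \<alpha>)"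
| "brk (L m i) (Hbar r \<beta>) (H p \<alpha>) = brk0 (L m i) (H p \<alpha>) (Hbar r \<beta>)"
| "brk (H p \<alpha>) (L m i) (Hbar r \<beta>) = - brk0 (L m i) (H p \<alpha>) (Hbar r \<beta>)"
| "brk (H p \<alpha>) (Hbar r \<beta>) (L m i) = brk0 (L m i) (H p \<alpha>) (Hbar r \<beta>)"
| "brk (Hbar r \<beta>) (L m i) (H p \<alpha>) = - brk0 (L m i) (H p \<alpha>) (Hbar r \<beta>)"
| "brk (Hbar r \<beta>) (H p \<alpha>) (L m i) = brk0 (L m i) (H p \<alpha>) (Hbar r \<beta>)"
| "brk a b c = brk0 a b c"

lemma cscale_bas: "cscale c (bas a) = Poly_Mapping.single a c"
  by (rule poly_mapping_eqI) (simp add: lookup_single when_def)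

lemma brk_swap12: "brk b a c = cscale (- ((-1) ^ (par a * par b))) (brk a b c)"
  by (cases a; cases b; cases c; simp add: cscale_bas flip: single_uminus)
     (simp_all add: algebra_simps)

lemma brk_swap23: "brk a c b = cscale (- ((-1) ^ (par b * par c))) (brk a b c)"
  by (cases a; cases b; cases c; simp add: cscale_bas flip: single_uminus)
     (simp_all add: algebra_simps)

lemma brk_par: "brk a b c \<in> w_comp (par a + par b + par c)"
  by (cases a; cases b; cases c; simp add: w_comp_def cscale_bas)

definition bracket :: "w_inf \<Rightarrow> w_inf \<Rightarrow> w_inf \<Rightarrow> w_inf" where
  "bracket u v z = lin_ext cscale (\<lambda>a. lin_ext cscale (\<lambda>b. lin_ext cscale (brk a b) z) v) u"

section \<open>The super exterior square\<close>

text \<open>\<open>(gen \<times> gen) \<Rightarrow>\<^sub>0 complex\<close> is the tensor square of \<open>w_inf\<close>; the exterior square is its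
  quotient by the span of the elements
  \<open>u \<otimes> v + (-1)\<^bsup>|u||v|\<^esup> v \<otimes> u\<close> with \<open>u\<close>, \<open>v\<close> homogeneous.\<close>

definition tensor :: "w_inf \<Rightarrow> w_inf \<Rightarrow> (gen \<times> gen \<Rightarrow>\<^sub>0 complex)" where
  "tensor u v = lin_ext cscale (\<lambda>a. lin_ext cscale (\<lambda>b. bas (a, b)) v) u"

definition ext_rel :: "(gen \<times> gen \<Rightarrow>\<^sub>0 complex) set" where
  "ext_rel = {tensor u v + cscale ((-1) ^ (p * q)) (tensor v u) | u v p q. u \<in> w_comp p \<and> v \<in> w_comp q}"

lemma linear_lin_ext_arg:
  assumes "vector_space s" "vector_space sc" "\<And>a. Vector_Spaces.linear s sc (G a)"
  shows "Vector_Spaces.linear s sc (\<lambda>v. lin_ext sc (\<lambda>a. G a v) u)"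
proof -
  interpret S: vector_space s by fact
  interpret V: vector_space sc by fact
  interpret P: vector_space_pair s sc by unfold_locales
  have "Vector_Spaces.linear s sc (\<lambda>v. sc c (G a v))" for a c
    using assms(3) by (rule linear_scale_right)
  then show ?thesis unfolding lin_ext_def by (intro P.linear_compose_sum) auto
qed

lemmas lin_lin = linear_lin_ext[OF pm.vector_space_axioms]
lemmas lin_lin_arg = linear_lin_ext_arg[OF pm.vector_space_axioms pm.vector_space_axioms]

lemma linear_bracket1: "Vector_Spaces.linear cscale cscale (\<lambda>u. bracket u v z)"
  and linear_bracket2: "Vector_Spaces.linear cscale cscale (\<lambda>v. bracket u v z)"
  and linear_bracket3: "Vector_Spaces.linear cscale cscale (\<lambda>z. bracket u v z)"
  unfolding bracket_def by (intro lin_lin lin_lin_arg)+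

lemma bracket_bas [simp]: "bracket (bas a) (bas b) (bas c) = brk a b c"
  by (simp add: bracket_def pm.vector_space_axioms)

lemma linear_tensor1: "Vector_Spaces.linear cscale cscale (\<lambda>u. tensor u v)"
  and linear_tensor2: "Vector_Spaces.linear cscale cscale (\<lambda>v. tensor u v)"
  unfolding tensor_def by (intro lin_lin lin_lin_arg)+

lemma tensor_bas [simp]: "tensor (bas a) (bas b) = bas (a, b)"
  by (simp add: tensor_def pm.vector_space_axioms)

lemma neg1_mod_cong: "p mod 2 = q mod 2 \<Longrightarrow> r mod 2 = s mod 2 \<Longrightarrow> (-1::complex) ^ (p * r) = (-1) ^ (q * s)"
  using mod_mult_cong[of p 2 q r s] by (simp add: minus_one_power_iff even_iff_mod_2_eq_zero)

lemma par_mod [simp]: "par a mod 2 = par a"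
  by (cases a) auto

text \<open>A linear map on the tensor square which is super skew-symmetric on the basis factors
  through the exterior square.\<close>

lemma ext_rel_respect:
  assumes F: "Vector_Spaces.linear cscale sc F"
    and skew: "\<And>a b. F (bas (a, b)) = sc (- ((-1) ^ (par a * par b))) (F (bas (b, a)))"
    and st: "s - t \<in> pm.span ext_rel"
  shows "F s = F t"
proof -
  interpret F: Vector_Spaces.linear cscale sc F by fact
  have "F r = 0" if r: "r \<in> ext_rel" for r
  proof -
    obtain u v p q where r: "r = tensor u v + cscale ((-1) ^ (p * q)) (tensor v u)"
      and u: "u \<in> w_comp p" and v: "v \<in> w_comp q"
      using r by (auto simp: ext_rel_def)
    have l1: "Vector_Spaces.linear cscale sc (\<lambda>u. F (tensor u v))"
             "Vector_Spaces.linear cscale sc (\<lambda>v. F (tensor u v))" for u v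
      using Vector_Spaces.linear_compose[OF linear_tensor1 F] Vector_Spaces.linear_compose[OF linear_tensor2 F]
      by (auto simp: o_def)
    have "F (tensor u v) = sc (- ((-1) ^ (p * q))) (F (tensor v u))"
    proof (rule linear_eq_on_supp[of sc "\<lambda>u. F (tensor u v)" "\<lambda>u. sc (- ((-1) ^ (p * q))) (F (tensor v u))"])
      fix a assume a: "a \<in> Poly_Mapping.keys u"
      show "F (tensor (bas a) v) = sc (- ((-1) ^ (p * q))) (F (tensor v (bas a)))"
      proof (rule linear_eq_on_supp[of sc "\<lambda>v. F (tensor (bas a) v)" "\<lambda>v. sc (- ((-1) ^ (p * q))) (F (tensor v (bas a)))"])
        fix b assume b: "b \<in> Poly_Mapping.keys v"
        have "(-1::complex) ^ (p * q) = (-1) ^ (par a * par b)"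
          using a b u v by (intro neg1_mod_cong) (auto simp: w_comp_def)
        then show "F (tensor (bas a) (bas b)) = sc (- ((-1) ^ (p * q))) (F (tensor (bas b) (bas a)))"
          using skew[of a b] by simp
      qed (intro l1 linear_scale_right)+
    qed (intro l1 linear_scale_right)+
    then show ?thesis by (simp add: r F.add F.scale F.vs2.scale_minus_left)
  qed
  then have "F (s - t) = 0"
    by (rule F.eq_0_on_span[OF _ st])
  then show ?thesis by (simp add: F.diff)
qed

quotient_type ext2 = "gen \<times> gen \<Rightarrow>\<^sub>0 complex" / "\<lambda>s t. s - t \<in> pm.span ext_rel"
proof (rule equivpI)
  show "reflp (\<lambda>s t. s - t \<in> pm.span ext_rel)"
    by (rule reflpI) (simp add: pm.span_zero)
  show "symp (\<lambda>s t. s - t \<in> pm.span ext_rel)"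
    by (rule sympI) (subst minus_diff_eq[symmetric], rule pm.span_neg)
  show "transp (\<lambda>s t. s - t \<in> pm.span ext_rel)"
  proof (rule transpI)
    fix r s t :: "gen \<times> gen \<Rightarrow>\<^sub>0 complex"
    assume "r - s \<in> pm.span ext_rel" "s - t \<in> pm.span ext_rel"
    then have "(r - s) + (s - t) \<in> pm.span ext_rel" by (rule pm.span_add)
    then show "r - t \<in> pm.span ext_rel" by simp
  qed
qed

lemma ext2_cases: obtains s where "x = abs_ext2 s"
  by (rule that[of "rep_ext2 x"]) (simp add: Quotient_abs_rep[OF Quotient_ext2])

instantiation ext2 :: ab_group_add
begin

lift_definition zero_ext2 :: ext2 is 0 .

lift_definition plus_ext2 :: "ext2 \<Rightarrow> ext2 \<Rightarrow> ext2" is "(+)"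
  unfolding add_diff_add by (rule pm.span_add)

lift_definition uminus_ext2 :: "ext2 \<Rightarrow> ext2" is uminus
  unfolding minus_diff_minus by (rule pm.span_neg)

lift_definition minus_ext2 :: "ext2 \<Rightarrow> ext2 \<Rightarrow> ext2" is "(-)"
proof -
  fix a b c d :: "gen \<times> gen \<Rightarrow>\<^sub>0 complex"
  assume "a - b \<in> pm.span ext_rel" "c - d \<in> pm.span ext_rel"
  then have "(a - b) - (c - d) \<in> pm.span ext_rel" by (rule pm.span_diff)
  then show "a - c - (b - d) \<in> pm.span ext_rel" by (simp add: algebra_simps)
qed

instance
  by standard (transfer; simp add: pm.span_zero algebra_simps)+

end

lift_definition escale :: "complex \<Rightarrow> ext2 \<Rightarrow> ext2" is cscale
  unfolding pm.scale_right_diff_distrib[symmetric] by (rule pm.span_scale)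

interpretation ext: vector_space escale
  by unfold_locales (transfer; simp add: pm.span_zero pm.scale_right_distrib pm.scale_left_distrib)+

definition wedge :: "w_inf \<Rightarrow> w_inf \<Rightarrow> ext2" (infixl "\<and>\<^sub>w" 72) where
  "u \<and>\<^sub>w v = abs_ext2 (tensor u v)"

text \<open>The homogeneous component of degree \<open>d mod 2\<close>.\<close>

definition ext_comp :: "nat \<Rightarrow> ext2 set" where
  "ext_comp d = ext.span {u \<and>\<^sub>w v | u v p q. u \<in> w_comp p \<and> v \<in> w_comp q \<and> (p + q) mod 2 = d mod 2}"

lemma linear_abs_ext2: "Vector_Spaces.linear cscale escale abs_ext2"
  by (rule vlinearI[OF pm.vector_space_axioms ext.vector_space_axioms])
     (simp_all add: plus_ext2.abs_eq escale.abs_eq)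

lemma linear_wedge1: "Vector_Spaces.linear cscale escale (\<lambda>u. u \<and>\<^sub>w v)"
  and linear_wedge2: "Vector_Spaces.linear cscale escale (\<lambda>v. u \<and>\<^sub>w v)"
  using Vector_Spaces.linear_compose[OF linear_tensor1 linear_abs_ext2] Vector_Spaces.linear_compose[OF linear_tensor2 linear_abs_ext2]
  by (auto simp: wedge_def o_def)

lemma wedge_swap:
  assumes "u \<in> w_comp p" "v \<in> w_comp q"
  shows "u \<and>\<^sub>w v = escale (- ((-1) ^ (p * q))) (v \<and>\<^sub>w u)"
proof -
  have "tensor u v - cscale (- ((-1) ^ (p * q))) (tensor v u) \<in> ext_rel"
    using assms by (auto simp: ext_rel_def pm.scale_minus_left)
  then show ?thesis
    unfolding wedge_def escale.abs_eq ext2.abs_eq_iff by (rule pm.span_base)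
qed

section \<open>The actions of the exterior square\<close>

text \<open>\<open>act (x\<^sub>1 \<and>\<^sub>w x\<^sub>2) z = [x\<^sub>1, x\<^sub>2, z]\<close>, extended linearly; see \<open>act_wedge\<close>.\<close>

lift_definition act :: "ext2 \<Rightarrow> w_inf \<Rightarrow> w_inf" is
  "\<lambda>s z. lin_ext cscale (\<lambda>(a, b). bracket (bas a) (bas b) z) s"
proof (rule HOL.ext)
  fix s t :: "gen \<times> gen \<Rightarrow>\<^sub>0 complex" and z
  assume st: "s - t \<in> pm.span ext_rel"
  let ?A = "lin_ext cscale (\<lambda>(a, b). bracket (bas a) (bas b) z)"
  show "?A s = ?A t"
  proof (rule ext_rel_respect[OF lin_lin _ st])
    fix a b
    have "bracket (bas a) (bas b) z = cscale (- ((-1) ^ (par a * par b))) (bracket (bas b) (bas a) z)"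
      by (rule linear_eq_on_supp[OF linear_bracket3 linear_scale_right[OF linear_bracket3]])
         (simp add: brk_swap12[of a b] mult.commute)
    then show "?A (bas (a, b)) = cscale (- ((-1) ^ (par a * par b))) (?A (bas (b, a)))"
      by (simp add: pm.vector_space_axioms)
  qed
qed

lemma act_abs: "act (abs_ext2 s) z = lin_ext cscale (\<lambda>(a, b). bracket (bas a) (bas b) z) s"
  by (simp add: act.abs_eq)

lemma linear_act1: "Vector_Spaces.linear escale cscale (\<lambda>x. act x z)"
proof (rule vlinearI[OF ext.vector_space_axioms pm.vector_space_axioms])
  interpret A: Vector_Spaces.linear cscale cscale "lin_ext cscale (\<lambda>(a, b). bracket (bas a) (bas b) z)"
    by (rule lin_lin)
  show "act (x + y) z = act x z + act y z" for x y
    by (rule ext2_cases[of x]; rule ext2_cases[of y]) (simp add: plus_ext2.abs_eq act_abs A.add)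
  show "act (escale c x) z = cscale c (act x z)" for c x
    by (rule ext2_cases[of x]) (simp add: escale.abs_eq act_abs A.scale)
qed

lemma linear_act2: "Vector_Spaces.linear cscale cscale (act x)"
proof (rule ext2_cases[of x])
  fix s assume abs_ext2: "x = abs_ext2 s"
  have "Vector_Spaces.linear cscale cscale (\<lambda>z. lin_ext cscale (\<lambda>ab. case ab of (a, b) \<Rightarrow> bracket (bas a) (bas b) z) s)"
    by (rule lin_lin_arg) (auto simp: linear_bracket3 split: prod.split)
  then show ?thesis by (simp add: abs_ext2 act_abs[abs_def])
qed

lemma bilinear_ext:
  assumes "\<And>v. Vector_Spaces.linear cscale sc (\<lambda>u. F u v)" "\<And>u. Vector_Spaces.linear cscale sc (F u)"
    and "\<And>v. Vector_Spaces.linear cscale sc (\<lambda>u. G u v)" "\<And>u. Vector_Spaces.linear cscale sc (G u)"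
    and "\<And>a b. a \<in> Poly_Mapping.keys u \<Longrightarrow> b \<in> Poly_Mapping.keys v \<Longrightarrow> F (bas a) (bas b) = G (bas a) (bas b)"
  shows "F u v = G u v"
  by (rule linear_eq_on_supp[OF assms(1,3)]) (rule linear_eq_on_supp[OF assms(2,4) assms(5)])

lemma act_wedge: "act (u \<and>\<^sub>w v) z = bracket u v z"
proof (rule bilinear_ext[of cscale "\<lambda>u v. act (u \<and>\<^sub>w v) z" "\<lambda>u v. bracket u v z"])
  show "Vector_Spaces.linear cscale cscale (\<lambda>u. act (u \<and>\<^sub>w v) z)" for v
    using Vector_Spaces.linear_compose[OF linear_wedge1 linear_act1] by (simp add: o_def)
  show "Vector_Spaces.linear cscale cscale (\<lambda>v. act (u \<and>\<^sub>w v) z)" for u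
    using Vector_Spaces.linear_compose[OF linear_wedge2 linear_act1] by (simp add: o_def)
  show "act (bas a \<and>\<^sub>w bas b) z = bracket (bas a) (bas b) z" for a b
    by (simp add: wedge_def act_abs pm.vector_space_axioms)
qed (rule linear_bracket1 linear_bracket2)+

text \<open>\<open>leib x y = [x, y]\<^sub>L\<close>; see \<open>leib_wedge\<close>.\<close>

definition leib_bas :: "gen \<Rightarrow> gen \<Rightarrow> gen \<Rightarrow> gen \<Rightarrow> (gen \<times> gen \<Rightarrow>\<^sub>0 complex)" where
  "leib_bas a b c d = tensor (bracket (bas a) (bas b) (bas c)) (bas d)
     + cscale ((-1) ^ ((par a + par b) * par c)) (tensor (bas c) (bracket (bas a) (bas b) (bas d)))"

lemma abs_leib_bas: "abs_ext2 (leib_bas a b c d) =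
    brk a b c \<and>\<^sub>w bas d + escale ((-1) ^ ((par a + par b) * par c)) (bas c \<and>\<^sub>w brk a b d)"
  by (simp add: leib_bas_def wedge_def flip: plus_ext2.abs_eq escale.abs_eq)

lemma bas_comp: "bas a \<in> w_comp (par a)"
  by (simp add: w_comp_def)

lemma abs_leib_bas_skew1:
  "abs_ext2 (leib_bas a b c d) = escale (- ((-1) ^ (par a * par b))) (abs_ext2 (leib_bas b a c d))"
proof -
  interpret W1: Vector_Spaces.linear cscale escale "\<lambda>u. u \<and>\<^sub>w v" for v by (rule linear_wedge1)
  interpret W2: Vector_Spaces.linear cscale escale "\<lambda>v. u \<and>\<^sub>w v" for u by (rule linear_wedge2)
  show ?thesis
    unfolding abs_leib_bas brk_swap12[where a = b and b = a] W1.scale W2.scale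
    unfolding ext.scale_right_distrib ext.scale_scale add.commute[of "par b" "par a"] mult.commute[of "par b" "par a"]
      mult.commute[of "- ((-1) ^ (par a * par b))"] ..
qed

lemma abs_leib_bas_skew2:
  "abs_ext2 (leib_bas a b c d) = escale (- ((-1) ^ (par c * par d))) (abs_ext2 (leib_bas a b d c))"
proof -
  have 1: "brk a b c \<and>\<^sub>w bas d = escale (- ((-1) ^ ((par a + par b + par c) * par d))) (bas d \<and>\<^sub>w brk a b c)"
    by (rule wedge_swap[OF brk_par bas_comp])
  have 2: "bas c \<and>\<^sub>w brk a b d = escale (- ((-1) ^ (par c * (par a + par b + par d)))) (brk a b d \<and>\<^sub>w bas c)"
    by (rule wedge_swap[OF bas_comp brk_par])
  let ?A = "par a + par b"
  let ?e = "\<lambda>n. (-1::complex) ^ n"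
  have X: "?e ((?A + par c) * par d) = ?e (par c * par d) * ?e (?A * par d)"
    by (simp add: add_mult_distrib power_add)
  have Y: "?e (?A * par c) * ?e (par c * (?A + par d)) = ?e (par c * par d)"
    unfolding add_mult_distrib2[of "par c" ?A] mult.commute[of "par c" ?A] power_add
    by (rule left_minus_one_mult_self)
  show ?thesis
    unfolding abs_leib_bas 1 2 ext.scale_right_distrib ext.scale_scale mult_minus_left mult_minus_right X Y
    by (rule add.commute)
qed

lemma abs_lin_ext: "abs_ext2 (lin_ext cscale F s) = lin_ext escale (\<lambda>a. abs_ext2 (F a)) s"
proof -
  interpret A: Vector_Spaces.linear cscale escale abs_ext2 by (rule linear_abs_ext2)
  show ?thesis by (simp add: lin_ext_def A.sum A.scale)
qed

lift_definition leib :: "ext2 \<Rightarrow> ext2 \<Rightarrow> ext2" is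
  "\<lambda>s t. lin_ext cscale (\<lambda>(a, b). lin_ext cscale (\<lambda>(c, d). leib_bas a b c d) t) s"
proof -
  fix s s' t t' :: "gen \<times> gen \<Rightarrow>\<^sub>0 complex"
  assume ss: "s - s' \<in> pm.span ext_rel" and tt: "t - t' \<in> pm.span ext_rel"
  let ?R = "\<lambda>s t. lin_ext cscale (\<lambda>(a, b). lin_ext cscale (\<lambda>(c, d). leib_bas a b c d) t) s"
  let ?I = "\<lambda>t a b. lin_ext escale (\<lambda>(c, d). abs_ext2 (leib_bas a b c d)) t"
  let ?M = "\<lambda>s t. lin_ext escale (\<lambda>(a, b). ?I t a b) s"
  note E = ext.vector_space_axioms
  have RM: "abs_ext2 (?R s t) = ?M s t" for s t
    by (simp only: abs_lin_ext split_def)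
  have 1: "?M s t = ?M s' t"
  proof (rule ext_rel_respect[OF linear_lin_ext[OF E] _ ss])
    fix a b
    have "?I t a b = escale (- ((-1) ^ (par a * par b))) (?I t b a)"
    proof (rule linear_eq_on_supp[of escale "\<lambda>t. ?I t a b" "\<lambda>t. escale (- ((-1) ^ (par a * par b))) (?I t b a)"])
      fix cd :: "gen \<times> gen"
      show "?I (bas cd) a b = escale (- ((-1) ^ (par a * par b))) (?I (bas cd) b a)"
        unfolding lin_ext_bas[OF E] split_def by (rule abs_leib_bas_skew1)
    qed (intro linear_scale_right linear_lin_ext[OF E])+
    then show "lin_ext escale (\<lambda>(a, b). ?I t a b) (bas (a, b)) =
        escale (- ((-1) ^ (par a * par b))) (lin_ext escale (\<lambda>(a, b). ?I t a b) (bas (b, a)))"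
      by (simp add: E)
  qed
  have 2: "?I t = ?I t'"
  proof (intro HOL.ext)
    fix a b
    show "?I t a b = ?I t' a b"
    proof (rule ext_rel_respect[OF linear_lin_ext[OF E] _ tt])
      fix c d
      show "lin_ext escale (\<lambda>(c, d). abs_ext2 (leib_bas a b c d)) (bas (c, d)) =
          escale (- ((-1) ^ (par c * par d))) (lin_ext escale (\<lambda>(c, d). abs_ext2 (leib_bas a b c d)) (bas (d, c)))"
        unfolding lin_ext_bas[OF E] prod.case by (rule abs_leib_bas_skew2)
    qed
  qed
  have "abs_ext2 (?R s t) = abs_ext2 (?R s' t')"
    by (rule trans[OF RM trans[OF trans[OF 1 arg_cong[OF 2, of "\<lambda>I. lin_ext escale (\<lambda>(a, b). I a b) s'"]] RM[symmetric]]])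
  then show "?R s t - ?R s' t' \<in> pm.span ext_rel"
    unfolding ext2.abs_eq_iff .
qed

lemma leib_abs: "leib (abs_ext2 s) (abs_ext2 t) =
    lin_ext escale (\<lambda>(a, b). lin_ext escale (\<lambda>(c, d). abs_ext2 (leib_bas a b c d)) t) s"
  by (simp only: leib.abs_eq abs_lin_ext split_def)

lemma linear_leib1: "Vector_Spaces.linear escale escale (\<lambda>x. leib x y)"
proof (rule ext2_cases[of y])
  fix t assume abs_ext2: "y = abs_ext2 t"
  note E = ext.vector_space_axioms
  interpret A: Vector_Spaces.linear cscale escale
      "lin_ext escale (\<lambda>(a, b). lin_ext escale (\<lambda>(c, d). abs_ext2 (leib_bas a b c d)) t)"
    by (rule linear_lin_ext[OF E])
  show ?thesis
  proof (rule vlinearI[OF E E])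
    show "leib (x1 + x2) y = leib x1 y + leib x2 y" for x1 x2
      by (rule ext2_cases[of x1]; rule ext2_cases[of x2]) (simp add: abs_ext2 plus_ext2.abs_eq leib_abs A.add)
    show "leib (escale c x) y = escale c (leib x y)" for c x
      by (rule ext2_cases[of x]) (simp add: abs_ext2 escale.abs_eq leib_abs A.scale)
  qed
qed

lemma linear_leib2: "Vector_Spaces.linear escale escale (leib x)"
proof (rule ext2_cases[of x])
  fix s assume abs_ext2: "x = abs_ext2 s"
  note E = ext.vector_space_axioms
  interpret A: Vector_Spaces.linear cscale escale
      "\<lambda>t. lin_ext escale (\<lambda>ab. case ab of (a, b) \<Rightarrow> lin_ext escale (\<lambda>(c, d). abs_ext2 (leib_bas a b c d)) t) s"
    by (rule linear_lin_ext_arg[OF pm.vector_space_axioms E]) (auto simp: linear_lin_ext E split: prod.split)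
  show ?thesis
  proof (rule vlinearI[OF E E])
    show "leib x (y1 + y2) = leib x y1 + leib x y2" for y1 y2
      by (rule ext2_cases[of y1]; rule ext2_cases[of y2]) (simp add: abs_ext2 plus_ext2.abs_eq leib_abs A.add)
    show "leib x (escale c y) = escale c (leib x y)" for c y
      by (rule ext2_cases[of y]) (simp add: abs_ext2 escale.abs_eq leib_abs A.scale)
  qed
qed

lemma leib_wedge:
  assumes "x \<in> ext_comp p" "y\<^sub>1 \<in> w_comp q"
  shows "leib x (y\<^sub>1 \<and>\<^sub>w y\<^sub>2) = act x y\<^sub>1 \<and>\<^sub>w y\<^sub>2 + escale ((-1) ^ (p * q)) (y\<^sub>1 \<and>\<^sub>w act x y\<^sub>2)"
proof -
  interpret L1: Vector_Spaces.linear escale escale "\<lambda>x. leib x y" for y by (rule linear_leib1)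
  interpret L2: Vector_Spaces.linear escale escale "leib w" for w by (rule linear_leib2)
  interpret A1: Vector_Spaces.linear escale cscale "\<lambda>x. act x z" for z by (rule linear_act1)
  interpret A2: Vector_Spaces.linear cscale cscale "act w" for w by (rule linear_act2)
  interpret W1: Vector_Spaces.linear cscale escale "\<lambda>u. u \<and>\<^sub>w v" for v by (rule linear_wedge1)
  interpret W2: Vector_Spaces.linear cscale escale "\<lambda>v. u \<and>\<^sub>w v" for u by (rule linear_wedge2)
  define D where "D = (\<lambda>x y z. act x y \<and>\<^sub>w z + escale ((-1) ^ (p * q)) (y \<and>\<^sub>w act x z))"
  note S = L1.add L1.scale L2.add L2.scale A1.add A1.scale A2.add A2.scale W1.add W1.scale W2.add W2.scale
    ext.scale_right_distrib mult.commute add_ac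
  note E = ext.vector_space_axioms
  note I = vlinearI[OF pm.vector_space_axioms E]
  have lD1: "Vector_Spaces.linear escale escale (\<lambda>x. D x y z)" for y z
    by (rule vlinearI[OF E E]) (simp_all add: D_def S)
  interpret D1: Vector_Spaces.linear escale escale "\<lambda>x. D x y z" for y z by (rule lD1)
  have base: "leib (bas a \<and>\<^sub>w bas b) (y\<^sub>1 \<and>\<^sub>w y\<^sub>2) = D (bas a \<and>\<^sub>w bas b) y\<^sub>1 y\<^sub>2"
    if ab: "(par a + par b) mod 2 = p mod 2" for a b
  proof (rule bilinear_ext[of escale "\<lambda>y\<^sub>1 y\<^sub>2. leib (bas a \<and>\<^sub>w bas b) (y\<^sub>1 \<and>\<^sub>w y\<^sub>2)" "\<lambda>y\<^sub>1 y\<^sub>2. D (bas a \<and>\<^sub>w bas b) y\<^sub>1 y\<^sub>2"])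
    fix c d assume "c \<in> Poly_Mapping.keys y\<^sub>1"
    then have "(-1::complex) ^ ((par a + par b) * par c) = (-1) ^ (p * q)"
      using assms(2) ab by (intro neg1_mod_cong) (auto simp: w_comp_def)
    moreover have "leib (bas a \<and>\<^sub>w bas b) (bas c \<and>\<^sub>w bas d) = abs_ext2 (leib_bas a b c d)"
      by (simp add: wedge_def leib_abs E)
    ultimately show "leib (bas a \<and>\<^sub>w bas b) (bas c \<and>\<^sub>w bas d) = D (bas a \<and>\<^sub>w bas b) (bas c) (bas d)"
      by (simp add: abs_leib_bas D_def act_wedge)
  qed (auto intro!: I simp: D_def S)
  have dec: "leib (u \<and>\<^sub>w v) (y\<^sub>1 \<and>\<^sub>w y\<^sub>2) = D (u \<and>\<^sub>w v) y\<^sub>1 y\<^sub>2"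
    if "u \<in> w_comp r" "v \<in> w_comp s" "(r + s) mod 2 = p mod 2" for u v r s
  proof (rule bilinear_ext[of escale "\<lambda>u v. leib (u \<and>\<^sub>w v) (y\<^sub>1 \<and>\<^sub>w y\<^sub>2)" "\<lambda>u v. D (u \<and>\<^sub>w v) y\<^sub>1 y\<^sub>2"])
    fix a b assume "a \<in> Poly_Mapping.keys u" "b \<in> Poly_Mapping.keys v"
    then have "(par a + par b) mod 2 = p mod 2"
      using that by (auto simp: w_comp_def mod_add_eq)
    then show "leib (bas a \<and>\<^sub>w bas b) (y\<^sub>1 \<and>\<^sub>w y\<^sub>2) = D (bas a \<and>\<^sub>w bas b) y\<^sub>1 y\<^sub>2"
      by (rule base)
  qed (auto intro!: I simp: D1.add D1.scale S)
  have "leib x (y\<^sub>1 \<and>\<^sub>w y\<^sub>2) = D x y\<^sub>1 y\<^sub>2"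
  proof -
    interpret EE: vector_space_pair escale escale by unfold_locales
    show ?thesis
      by (rule EE.linear_eq_on_span[OF linear_leib1 lD1 _ assms(1)[unfolded ext_comp_def]]) (use dec in auto)
  qed
  then show ?thesis by (simp add: D_def)
qed

section \<open>Cohomology with trivial coefficients\<close>

text \<open>The parity of the trivial module: \<open>\<complex>\<close> is purely even.\<close>

definition triv_comp :: "nat \<Rightarrow> complex set" where
  "triv_comp d = (if even d then UNIV else {0})"

definition bilin :: "(ext2 \<Rightarrow> w_inf \<Rightarrow> complex) \<Rightarrow> bool" where
  "bilin f \<longleftrightarrow> (\<forall>z. Vector_Spaces.linear escale (*) (\<lambda>x. f x z)) \<and> (\<forall>x. Vector_Spaces.linear cscale (*) (f x))"

definition even_map :: "(ext2 \<Rightarrow> w_inf \<Rightarrow> complex) \<Rightarrow> bool" where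
  "even_map f \<longleftrightarrow> (\<forall>p q. \<forall>x\<in>ext_comp p. \<forall>z\<in>w_comp q. f x z \<in> triv_comp (p + q))"

text \<open>\<open>p\<close> and \<open>q\<close> are the parities of the homogeneous arguments \<open>x\<close> and \<open>y\<close>.\<close>

definition delta2 :: "nat \<Rightarrow> nat \<Rightarrow> (ext2 \<Rightarrow> w_inf \<Rightarrow> complex) \<Rightarrow> ext2 \<Rightarrow> ext2 \<Rightarrow> w_inf \<Rightarrow> complex" where
  "delta2 p q f x y z = - f (leib x y) z - (-1) ^ (p * q) * f y (act x z) + f x (act y z)"

definition delta1 :: "(w_inf \<Rightarrow> complex) \<Rightarrow> ext2 \<Rightarrow> w_inf \<Rightarrow> complex" where
  "delta1 g x z = - g (act x z)"

definition Z2 :: "(ext2 \<Rightarrow> w_inf \<Rightarrow> complex) set" where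
  "Z2 = {f. bilin f \<and> (\<forall>p q. \<forall>x\<in>ext_comp p. \<forall>y\<in>ext_comp q. \<forall>z. delta2 p q f x y z = 0)}"

definition B2 :: "(ext2 \<Rightarrow> w_inf \<Rightarrow> complex) set" where
  "B2 = {delta1 g | g. Vector_Spaces.linear cscale (*) g}"

definition Z2_even :: "(ext2 \<Rightarrow> w_inf \<Rightarrow> complex) set" where
  "Z2_even = {f \<in> Z2. even_map f}"

definition B2_even :: "(ext2 \<Rightarrow> w_inf \<Rightarrow> complex) set" where
  "B2_even = {f \<in> B2. even_map f}"

text \<open>The coset \<open>f + B2_even\<close>; \<open>H2_even\<close> is the set of cosets \<open>Z2_even / B2_even\<close>, with zero
  element \<open>H2_class 0\<close>.\<close>

definition H2_class :: "(ext2 \<Rightarrow> w_inf \<Rightarrow> complex) \<Rightarrow> (ext2 \<Rightarrow> w_inf \<Rightarrow> complex) set" where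
  "H2_class f = {\<lambda>x z. f x z + b x z | b. b \<in> B2_even}"

definition H2_even :: "(ext2 \<Rightarrow> w_inf \<Rightarrow> complex) set set" where
  "H2_even = H2_class ` Z2_even"

end

theory Submission
  imports Defs
begin

text \<open>The element \<open>X = L\<^sub>1\<^sup>0 \<and> L\<^sub>-\<^sub>1\<^sup>1 - L\<^sub>0\<^sup>0 \<and> L\<^sub>0\<^sup>1\<close> acts diagonally on the basis: a basis vector with
  upper index \<open>h\<close> (or \<open>h + 1/2\<close>) has eigenvalue \<open>1 - 2h\<close>. Evaluating the cocycle condition of \<open>f\<close>
  on \<open>X\<close>, \<open>c \<and> d\<close> and \<open>e\<close> gives \<open>\<lambda> f(c \<and> d, e) = f(X, [c, d, e])\<close>, where \<open>\<lambda> = 3 - 2(i + j + l)\<close>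
  is the sum of the eigenvalues of \<open>c\<close>, \<open>d\<close>, \<open>e\<close>. It is odd, hence nonzero, and it is
  also the eigenvalue of \<open>X\<close> on \<open>[c, d, e]\<close>. So \<open>f\<close> is the coboundary of the linear form
  \<open>u \<mapsto> - f(X, E\<^sup>-\<^sup>1 u)\<close>, where \<open>E\<close> is the action of \<open>X\<close>.\<close>

fun upper :: "gen \<Rightarrow> nat" where
  "upper (L _ i) = i"
| "upper (Lbar _ i) = i"
| "upper (H _ i) = i"
| "upper (Hbar _ i) = i"

definition eigenvalue :: "gen \<Rightarrow> complex" where
  "eigenvalue a = of_int (1 - 2 * int (upper a))"

text \<open>On a basis vector of lower index k and upper part h the first wedge alone acts by 1 - k
  - 2h, the second by -k; the difference is free of k.\<close>

definition diag_elt :: ext2 where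
  "diag_elt = bas (L 1 0) \<and>\<^sub>w bas (L (-1) 1) - bas (L 0 0) \<and>\<^sub>w bas (L 0 1)"

lemma vector_space_mult: "vector_space ((*) :: complex \<Rightarrow> complex \<Rightarrow> complex)"
  by unfold_locales (auto simp: algebra_simps)

lemma eigenvalue_nonzero: "eigenvalue a \<noteq> 0"
proof -
  have "1 - 2 * int (upper a) \<noteq> 0" by presburger
  then show ?thesis unfolding eigenvalue_def of_int_eq_0_iff .
qed

lemma eigenvalue_sum_nonzero: "eigenvalue a + eigenvalue b + eigenvalue c \<noteq> 0"
proof -
  have "(1 - 2 * int (upper a)) + (1 - 2 * int (upper b)) + (1 - 2 * int (upper c)) \<noteq> 0"
    by presburger
  then show ?thesis unfolding eigenvalue_def of_int_add[symmetric] of_int_eq_0_iff .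
qed

lemma act_diag_elt: "act diag_elt (bas a) = cscale (eigenvalue a) (bas a)"
proof -
  interpret A: Vector_Spaces.linear escale cscale "\<lambda>x. act x (bas a)" by (rule linear_act1)
  show ?thesis
    unfolding diag_elt_def A.diff act_wedge bracket_bas
    by (cases a) (simp_all add: eigenvalue_def cscale_bas mult.commute flip: single_diff)
qed

lemma diag_elt_comp: "diag_elt \<in> ext_comp 0"
  unfolding diag_elt_def ext_comp_def
  using bas_comp[of "L _ _"] by (intro ext.span_diff ext.span_base) fastforce+

lemma wedge_bas_comp: "bas c \<and>\<^sub>w bas d \<in> ext_comp (par c + par d)"
  unfolding ext_comp_def by (rule ext.span_base) (use bas_comp in blast)

text \<open>As \<open>diag_elt\<close> is even, the sign in \<open>leib_wedge\<close> is 1 and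
  eigenvalues add as for an ordinary derivation.\<close>

lemma leib_diag_elt:
  "leib diag_elt (bas c \<and>\<^sub>w bas d) = escale (eigenvalue c + eigenvalue d) (bas c \<and>\<^sub>w bas d)"
proof -
  interpret W1: Vector_Spaces.linear cscale escale "\<lambda>u. u \<and>\<^sub>w v" for v by (rule linear_wedge1)
  interpret W2: Vector_Spaces.linear cscale escale "\<lambda>v. u \<and>\<^sub>w v" for u by (rule linear_wedge2)
  show ?thesis
    by (simp add: leib_wedge[OF diag_elt_comp bas_comp] act_diag_elt W1.scale W2.scale
        ext.scale_left_distrib)
qed

text \<open>Captures the shape common to the five defining brackets: a coefficient k times one basis
  vector.\<close>

lemma act_diag_elt_scaled:
  assumes "upper c + upper d + upper e = 0 \<Longrightarrow> k = 0"
    and "upper a = upper c + upper d + upper e - 1"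
  shows "act diag_elt (cscale k (bas a)) =
    cscale (eigenvalue c + eigenvalue d + eigenvalue e) (cscale k (bas a))"
proof -
  interpret A: Vector_Spaces.linear cscale cscale "act diag_elt" by (rule linear_act2)
  show ?thesis
  proof (cases "k = 0")
    case True
    then show ?thesis by (simp only: A.zero pm.scale_zero_left pm.scale_zero_right)
  next
    case False
    \<comment> \<open>Since k is nonzero, some upper index is positive, so the subtraction is not
      truncated and, with s the sum of the upper indices, 1 - 2(s - 1) = 3 - 2s.\<close>
    then have "int (upper a) = int (upper c) + int (upper d) + int (upper e) - 1"
      using assms by linarith
    then have "eigenvalue a = eigenvalue c + eigenvalue d + eigenvalue e"
      unfolding eigenvalue_def of_int_add[symmetric] of_int_eq_iff by presburger
    then show ?thesis
      by (simp only: A.scale act_diag_elt pm.scale_left_commute)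
  qed
qed

lemma act_diag_elt_brk0:
  "act diag_elt (brk0 c d e) = cscale (eigenvalue c + eigenvalue d + eigenvalue e) (brk0 c d e)"
proof -
  interpret A: Vector_Spaces.linear cscale cscale "act diag_elt" by (rule linear_act2)
  show ?thesis
    by (induction c d e rule: brk0.induct;
        (simp only: brk0.simps A.zero pm.scale_zero_right; fail)?;
        simp only: brk0.simps, rule act_diag_elt_scaled; simp)
qed

text \<open>Each clause of \<open>brk\<close> is, up to sign, \<open>brk0\<close> at permuted
  arguments, and the eigenvalue sum is symmetric.\<close>

lemma act_diag_elt_brk:
  "act diag_elt (brk c d e) = cscale (eigenvalue c + eigenvalue d + eigenvalue e) (brk c d e)"
proof -
  interpret A: Vector_Spaces.linear cscale cscale "act diag_elt" by (rule linear_act2)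
  show ?thesis
    by (induction c d e rule: brk.induct;
        simp only: brk.simps A.neg act_diag_elt_brk0 pm.scale_minus_right add_ac)
qed

lemma cocycle_eigenvalue:
  assumes "f \<in> Z2"
  shows "(eigenvalue c + eigenvalue d + eigenvalue e) * f (bas c \<and>\<^sub>w bas d) (bas e) = f diag_elt (brk c d e)"
proof -
  interpret F1: Vector_Spaces.linear escale "(*)" "\<lambda>x. f x z" for z
    using assms by (simp add: Z2_def bilin_def)
  interpret F2: Vector_Spaces.linear cscale "(*)" "f x" for x
    using assms by (simp add: Z2_def bilin_def)
  have "delta2 0 (par c + par d) f diag_elt (bas c \<and>\<^sub>w bas d) (bas e) = 0"
    using assms diag_elt_comp wedge_bas_comp by (simp add: Z2_def)
  \<comment> \<open>The \<open>leib\<close> term contributes the eigenvalues of c and d, the second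
    term that of e, with sign 1 as \<open>diag_elt\<close> has parity 0.\<close>
  then have "f diag_elt (brk c d e) -
      (eigenvalue c + eigenvalue d + eigenvalue e) * f (bas c \<and>\<^sub>w bas d) (bas e) = 0"
    unfolding delta2_def leib_diag_elt act_diag_elt act_wedge bracket_bas F1.scale F2.scale
    by (simp add: algebra_simps)
  then show ?thesis by simp
qed

text \<open>Pulling back along \<open>abs_ext2\<close> reduces the claim to the basis of the tensor
  square.\<close>

lemma bilin_eqI:
  assumes "bilin f" "bilin g" "\<And>c d e. f (bas c \<and>\<^sub>w bas d) (bas e) = g (bas c \<and>\<^sub>w bas d) (bas e)"
  shows "f = g"
proof (intro HOL.ext)
  fix x z
  have l: "Vector_Spaces.linear cscale (*) (\<lambda>s. h (abs_ext2 s) z)" if "bilin h" for h z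
    using Vector_Spaces.linear_compose[OF linear_abs_ext2, of "(*)" "\<lambda>x. h x z"] that
    by (simp add: bilin_def o_def)
  obtain s where x: "x = abs_ext2 s" by (rule ext2_cases)
  have "f (abs_ext2 s) z = g (abs_ext2 s) z"
  proof (rule bilinear_ext[of "(*)" "\<lambda>s. f (abs_ext2 s)" "\<lambda>s. g (abs_ext2 s)"])
    show "f (abs_ext2 (bas p)) (bas e) = g (abs_ext2 (bas p)) (bas e)" for p e
      using assms(3)[of "fst p" "snd p" e] by (simp add: wedge_def)
  qed (use assms in \<open>auto simp: l bilin_def\<close>)
  then show "f x z = g x z" by (simp add: x)
qed

lemma bilin_delta1:
  assumes "Vector_Spaces.linear cscale (*) g"
  shows "bilin (delta1 g)"
proof -
  interpret G: Vector_Spaces.linear cscale "(*)" g by fact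
  interpret A1: Vector_Spaces.linear escale cscale "\<lambda>x. act x z" for z by (rule linear_act1)
  interpret A2: Vector_Spaces.linear cscale cscale "act w" for w by (rule linear_act2)
  show ?thesis
    unfolding bilin_def delta1_def
    by (auto intro!: vlinearI ext.vector_space_axioms pm.vector_space_axioms vector_space_mult
        simp: A1.add A1.scale A2.add A2.scale G.add G.scale)
qed

lemma Z2_subset_B2: "Z2 \<subseteq> B2"
proof
  fix f assume f: "f \<in> Z2"
  then have bilin: "bilin f" by (simp add: Z2_def)
  interpret F2: Vector_Spaces.linear cscale "(*)" "f x" for x
    using bilin by (simp add: bilin_def)
  \<comment> \<open>The action of \<open>diag_elt\<close> is diagonal, so its inverse is division by
    \<open>eigenvalue\<close> on the basis.\<close>
  define g where "g = lin_ext (*) (\<lambda>a. - f diag_elt (bas a) / eigenvalue a)"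
  have lin_g: "Vector_Spaces.linear cscale (*) g"
    unfolding g_def by (rule linear_lin_ext[OF vector_space_mult])
  interpret G: Vector_Spaces.linear cscale "(*)" g by (rule lin_g)
  interpret A: Vector_Spaces.linear cscale cscale "act diag_elt" by (rule linear_act2)
  have fX: "f diag_elt u = - g (act diag_elt u)" for u
  proof (rule linear_eq_on_supp[of "(*)" "f diag_elt" "\<lambda>u. - g (act diag_elt u)"])
    show "Vector_Spaces.linear cscale (*) (f diag_elt)" by (rule F2.linear_axioms)
    show "Vector_Spaces.linear cscale (*) (\<lambda>u. - g (act diag_elt u))"
      by (rule vlinearI[OF pm.vector_space_axioms vector_space_mult])
         (simp_all add: A.add A.scale G.add G.scale)
    show "f diag_elt (bas a) = - g (act diag_elt (bas a))" for a
      unfolding act_diag_elt G.scale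
      by (simp add: g_def lin_ext_bas[OF vector_space_mult] eigenvalue_nonzero)
  qed
  have "f = delta1 g"
  proof (rule bilin_eqI[OF bilin bilin_delta1[OF lin_g]])
    fix c d e
    let ?s = "eigenvalue c + eigenvalue d + eigenvalue e"
    have "?s * f (bas c \<and>\<^sub>w bas d) (bas e) = - g (act diag_elt (brk c d e))"
      unfolding cocycle_eigenvalue[OF f] fX ..
    \<comment> \<open>The bracket is an eigenvector for the same \<open>?s\<close>, which therefore
      cancels.\<close>
    also have "\<dots> = ?s * - g (brk c d e)"
      unfolding act_diag_elt_brk G.scale by (rule mult_minus_right[symmetric])
    finally have "f (bas c \<and>\<^sub>w bas d) (bas e) = - g (brk c d e)"
      unfolding mult_left_cancel[OF eigenvalue_sum_nonzero] .
    then show "f (bas c \<and>\<^sub>w bas d) (bas e) = delta1 g (bas c \<and>\<^sub>w bas d) (bas e)"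
      by (simp add: delta1_def act_wedge)
  qed
  with lin_g show "f \<in> B2" by (auto simp: B2_def)
qed

text \<open>The values t = 1 and t = -1 give the two inclusions between cosets below.\<close>

lemma B2_even_lincomb:
  assumes "a \<in> B2_even" "b \<in> B2_even"
  shows "(\<lambda>x z. a x z + t * b x z) \<in> B2_even"
proof -
  obtain g where g: "Vector_Spaces.linear cscale (*) g" "a = delta1 g"
    using assms(1) unfolding B2_even_def B2_def by blast
  obtain h where h: "Vector_Spaces.linear cscale (*) h" "b = delta1 h"
    using assms(2) unfolding B2_even_def B2_def by blast
  interpret P: vector_space_pair cscale "(*) :: complex \<Rightarrow> complex \<Rightarrow> complex"
    using pm.vector_space_axioms vector_space_mult by (rule vector_space_pair.intro)
  have "Vector_Spaces.linear cscale (*) (\<lambda>u. g u + t * h u)"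
    using g(1) linear_scale_right[OF h(1)] by (rule P.linear_compose_add)
  moreover have "(\<lambda>x z. a x z + t * b x z) = delta1 (\<lambda>u. g u + t * h u)"
    unfolding g(2) h(2) delta1_def by simp
  moreover have "even_map (\<lambda>x z. a x z + t * b x z)"
    unfolding even_map_def
  proof (intro allI ballI)
    fix p q x z assume "x \<in> ext_comp p" "z \<in> w_comp q"
    then have "a x z \<in> triv_comp (p + q)" "b x z \<in> triv_comp (p + q)"
      using assms by (auto simp: B2_even_def even_map_def)
    then show "a x z + t * b x z \<in> triv_comp (p + q)"
      by (simp add: triv_comp_def split: if_splits)
  qed
  ultimately show ?thesis by (auto simp: B2_even_def B2_def)
qed

lemma zero_in_Z2_even: "(\<lambda>x z. 0) \<in> Z2_even"
  by (auto simp: Z2_even_def Z2_def bilin_def even_map_def delta2_def triv_comp_def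
      intro!: vlinearI ext.vector_space_axioms pm.vector_space_axioms vector_space_mult)

lemma H2_class_coboundary:
  assumes "f \<in> B2_even"
  shows "H2_class f = H2_class (\<lambda>x z. 0)"
proof -
  have "(\<lambda>x z. f x z + b x z) \<in> B2_even" if "b \<in> B2_even" for b
    using B2_even_lincomb[OF assms that, of 1] by simp
  \<comment> \<open>The witness is b - f.\<close>
  moreover have "\<exists>b'\<in>B2_even. b = (\<lambda>x z. f x z + b' x z)" if "b \<in> B2_even" for b
    using B2_even_lincomb[OF that assms, of "-1"]
    by (intro bexI[of _ "\<lambda>x z. b x z + - 1 * f x z"]) auto
  ultimately show ?thesis by (auto simp: H2_class_def)
qed

theorem theorem6p3:
  shows "H2_even = {H2_class (\<lambda>x z. 0)}"
proof -
  \<comment> \<open>Evenness is imposed on the map f rather than on g, so the inclusion restricts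
    directly to even maps.\<close>
  have "Z2_even \<subseteq> B2_even"
    using Z2_subset_B2 by (auto simp: Z2_even_def B2_even_def)
  then show ?thesis
    using zero_in_Z2_even H2_class_coboundary by (auto simp: H2_even_def)
qed

end
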